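(* Let $T\in\mathcal{B}^{0,1}(V_n)$, suppose that $B\in\mathcal{B}(V_n)$ commutes with $T$, and let $s\in\rho_S(T)$. Then the modified left $S$-resolvent operator satisfies $$S_L^{-1}(s,T;B)s-TS_L^{-1}(s,T;B)=BS_L^{-1}(s,T)s-TBS_L^{-1}(s,T)=B,$$ and the modified right $S$-resolvent operator satisfies $$sS_R^{-1}(s,T;B)-S_R^{-1}(s,T;B)T=sS_R^{-1}(s,T)B-S_R^{-1}(s,T)BT=B.$$
   Context: $\mathbb{R}_n$ is the real Clifford algebra generated by $e_1,\dots,e_n$ with $e_\ell e_m+e_me_\ell=0$ ($\ell\ne m$), $e_\ell^2=-1$, with basis $e_A$. A point of $\mathbb{R}^{n+1}$ is identified with the paravector $s=s_0+\sum_{\ell=1}^n s_\ell e_\ell$; $\mathrm{Re}(s)=s_0$, $\overline{s}=s_0-\sum s_\ell e_\ell$, $|s|^2=\sum_{\ell=0}^ns_\ell^2$. $V$ is a real Banach space, $V_n=V\otimes\mathbb{R}_n$ with elements $\sum_Av_Ae_A$ and $\|v\|^2=\sum_A\|v_A\|^2$, a two-sided $\mathbb{R}_n$-module. $\mathcal{B}(V_n)$ is the set of Clifford operators $T=\sum_Ae_AT_A$, $T_A$ bounded linear on $V$, acting by $T(\sum_B v_Be_B)=\sum_{A,B}T_A(v_B)e_Ae_B$; for $a\in\mathbb{R}_n$, $(aT)(v)=a\,T(v)$, $(Ta)(v)=T(av)$. $\mathcal{B}^{0,1}(V_n)$ is the set of paravector operators $T=T_0+\sum_{j=1}^ne_jT_j$.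 For $s\in\mathbb{R}^{n+1}$: $\mathcal{Q}_s(T)=T^2-2\mathrm{Re}(s)T+|s|^2\mathcal{I}$; $\rho_S(T)=\{s\in\mathbb{R}^{n+1}:\mathcal{Q}_s(T)\text{ invertible in }\mathcal{B}(V_n)\}$. For $s\in\rho_S(T)$: $S_L^{-1}(s,T)=-\mathcal{Q}_s(T)^{-1}(T-\overline{s}\mathcal{I})$, $S_R^{-1}(s,T)=-(T-\overline{s}\mathcal{I})\mathcal{Q}_s(T)^{-1}$, and for $B\in\mathcal{B}(V_n)$ the modified $S$-resolvent operators are $$S_L^{-1}(s,T;B)=-\mathcal{Q}_s(T)^{-1}(TB-B\overline{s}),\qquad S_R^{-1}(s,T;B)=-(BT-\overline{s}B)\mathcal{Q}_s(T)^{-1}.$$ *)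

theory Defs
  imports "HOL-Analysis.Analysis"
begin

text \<open>
  The index set \<open>{1, \<dots>, n}\<close> is a finite linearly ordered type \<open>'n\<close>. The basis element
  \<open>e\<^sub>A\<close> is the product of the generators \<open>e\<^sub>j\<close>, \<open>j \<in> A\<close>, in increasing order, so that
  \<open>V\<^sub>n = V \<otimes> \<real>\<^sub>n\<close> is \<open>('v, 'n) clmod\<close>: the component at \<open>A\<close> is the coefficient of \<open>e\<^sub>A\<close>,
  \<open>axis A v\<close> is \<open>v e\<^sub>A\<close>, and the norm of the vector type is the one induced by
  \<open>\<Sum>\<^sub>A \<parallel>v\<^sub>A\<parallel>\<^sup>2\<close>. The algebra \<open>\<real>\<^sub>n\<close> is the case \<open>'v = real\<close>; its product is
  \<open>clifford_mult\<close> below, not the componentwise \<open>*\<close> of the vector type.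
\<close>

type_synonym ('v, 'n) clmod = "('v, 'n set) vec"
type_synonym ('v, 'n) clop = "('v, 'n) clmod \<Rightarrow>\<^sub>L ('v, 'n) clmod"
type_synonym 'n point = "real \<times> (real, 'n) vec"

text \<open>
  Sign with \<open>e\<^sub>A e\<^sub>B = clifford_sign A B e\<^bsub>A \<triangle> B\<^esub>\<close>: every pair \<open>b < a\<close> costs one transposition,
  every \<open>a = b\<close> one \<open>e\<^sub>a\<^sup>2 = -1\<close>.
\<close>
definition clifford_sign :: "'n::{finite,linorder} set \<Rightarrow> 'n set \<Rightarrow> real" where
  "clifford_sign A B = (-1) ^ card {(a, b). a \<in> A \<and> b \<in> B \<and> b \<le> a}"

text \<open>The operator \<open>\<Sum>\<^sub>A e\<^sub>A T\<^sub>A\<close>.\<close>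
lift_definition clifford_op ::
  "('n::{finite,linorder} set \<Rightarrow> 'v::real_normed_vector \<Rightarrow>\<^sub>L 'v) \<Rightarrow> ('v, 'n) clop"
  is "\<lambda>T v. \<Sum>A\<in>UNIV. \<Sum>B\<in>UNIV. axis (sym_diff A B) (clifford_sign A B *\<^sub>R blinfun_apply (T A) (v $ B))"
proof -
  fix T :: "'n set \<Rightarrow> 'v \<Rightarrow>\<^sub>L 'v"
  have axis: "bounded_linear (axis k :: 'v \<Rightarrow> ('v, 'n) clmod)" for k
  proof (rule bounded_linear_intro[where K = 1])
    show "axis k (x + y) = axis k x + (axis k y :: ('v, 'n) clmod)" for x y
      by (simp add: axis_def vec_eq_iff)
    show "axis k (r *\<^sub>R x) = r *\<^sub>R (axis k x :: ('v, 'n) clmod)" for r x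
      by (simp add: axis_def vec_eq_iff)
    show "norm (axis k x :: ('v, 'n) clmod) \<le> norm x * 1" for x
    proof -
      have "norm (axis k x :: ('v, 'n) clmod) \<le> (\<Sum>i\<in>UNIV. norm ((axis k x :: ('v, 'n) clmod) $ i))"
        unfolding norm_vec_def by (rule L2_set_le_sum) simp
      also have "\<dots> = (\<Sum>i\<in>UNIV. if i = k then norm x else 0)"
        by (intro sum.cong) (auto simp: axis_def)
      finally show ?thesis by simp
    qed
  qed
  show "bounded_linear (\<lambda>v. \<Sum>A\<in>UNIV. \<Sum>B\<in>UNIV.
      axis (sym_diff A B) (clifford_sign A B *\<^sub>R blinfun_apply (T A) (v $ B)))"
    by (intro bounded_linear_sum bounded_linear_compose[OF axis]
        bounded_linear_const_scaleR bounded_linear_compose[OF blinfun.bounded_linear_right]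
        bounded_linear_vec_nth)
qed

text \<open>\<open>\<B>(V\<^sub>n)\<close> and its subset \<open>\<B>\<^bsup>0,1\<^esup>(V\<^sub>n)\<close> of operators \<open>T\<^sub>0 + \<Sum>\<^sub>j e\<^sub>j T\<^sub>j\<close>.\<close>
definition clifford_operators ::
  "('v::real_normed_vector, 'n::{finite,linorder}) clop set" where
  "clifford_operators = range clifford_op"

definition paravector_operators ::
  "('v::real_normed_vector, 'n::{finite,linorder}) clop set" where
  "paravector_operators =
     {clifford_op T | T. \<forall>A. A \<noteq> {} \<and> (\<nexists>j. A = {j}) \<longrightarrow> T A = 0}"

text \<open>Left multiplication of \<open>V\<^sub>n\<close> by an element of \<open>\<real>\<^sub>n\<close>.\<close>
definition clifford_mult ::
  "(real, 'n::{finite,linorder}) clmod \<Rightarrow> ('v::real_normed_vector, 'n) clop" where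
  "clifford_mult a = clifford_op (\<lambda>A. (a $ A) *\<^sub>R id_blinfun)"

definition op_lmult ::
  "(real, 'n::{finite,linorder}) clmod \<Rightarrow> ('v::real_normed_vector, 'n) clop
     \<Rightarrow> ('v, 'n) clop" (infixr "\<cdot>\<^sub>l" 70) where
  "a \<cdot>\<^sub>l T = clifford_mult a o\<^sub>L T"

definition op_rmult ::
  "('v::real_normed_vector, 'n::{finite,linorder}) clop \<Rightarrow> (real, 'n) clmod
     \<Rightarrow> ('v, 'n) clop" (infixl "\<cdot>\<^sub>r" 70) where
  "T \<cdot>\<^sub>r a = T o\<^sub>L clifford_mult a"

text \<open>
  A point \<open>s = (s\<^sub>0, (s\<^sub>1, \<dots>, s\<^sub>n))\<close> of \<open>\<real>\<^bsup>n+1\<^esup>\<close> is a pair, so that \<open>Re(s)\<close> is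
  \<open>fst s\<close> and \<open>|s|\<close> is the norm of the product type.
\<close>
definition paravector :: "'n::{finite,linorder} point \<Rightarrow> (real, 'n) clmod" where
  "paravector s = axis {} (fst s) + (\<Sum>j\<in>UNIV. axis {j} (snd s $ j))"

definition conj_point :: "'n::{finite,linorder} point \<Rightarrow> 'n point" where
  "conj_point s = (fst s, - snd s)"

definition Q_op ::
  "'n::{finite,linorder} point \<Rightarrow> ('v::real_normed_vector, 'n) clop
     \<Rightarrow> ('v, 'n) clop" where
  "Q_op s T = (T o\<^sub>L T) - (2 * fst s) *\<^sub>R T + (norm s)\<^sup>2 *\<^sub>R id_blinfun"

definition is_clifford_inverse ::
  "('v::real_normed_vector, 'n::{finite,linorder}) clop
     \<Rightarrow> ('v, 'n) clop \<Rightarrow> bool" where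
  "is_clifford_inverse T S \<longleftrightarrow>
     S \<in> clifford_operators \<and> S o\<^sub>L T = id_blinfun \<and> T o\<^sub>L S = id_blinfun"

definition clifford_inverse ::
  "('v::real_normed_vector, 'n::{finite,linorder}) clop
     \<Rightarrow> ('v, 'n) clop" where
  "clifford_inverse T = (THE S. is_clifford_inverse T S)"

definition S_resolvent_set ::
  "('v::real_normed_vector, 'n::{finite,linorder}) clop
     \<Rightarrow> 'n point set" where
  "S_resolvent_set T = {s. \<exists>S. is_clifford_inverse (Q_op s T) S}"

definition SL_resolvent ::
  "'n::{finite,linorder} point \<Rightarrow> ('v::real_normed_vector, 'n) clop
     \<Rightarrow> ('v, 'n) clop" where
  "SL_resolvent s T = - (clifford_inverse (Q_op s T) o\<^sub>L (T - paravector (conj_point s) \<cdot>\<^sub>l id_blinfun))"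

definition SR_resolvent ::
  "'n::{finite,linorder} point \<Rightarrow> ('v::real_normed_vector, 'n) clop
     \<Rightarrow> ('v, 'n) clop" where
  "SR_resolvent s T = - ((T - paravector (conj_point s) \<cdot>\<^sub>l id_blinfun) o\<^sub>L clifford_inverse (Q_op s T))"

text \<open>The modified \<open>S\<close>-resolvent operators \<open>S\<^sub>L\<^sup>-\<^sup>1(s, T; B)\<close> and \<open>S\<^sub>R\<^sup>-\<^sup>1(s, T; B)\<close>.\<close>
definition SL_resolvent_mod ::
  "'n::{finite,linorder} point \<Rightarrow> ('v::real_normed_vector, 'n) clop
     \<Rightarrow> ('v, 'n) clop \<Rightarrow> ('v, 'n) clop" where
  "SL_resolvent_mod s T B =
     - (clifford_inverse (Q_op s T) o\<^sub>L ((T o\<^sub>L B) - B \<cdot>\<^sub>r paravector (conj_point s)))"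

definition SR_resolvent_mod ::
  "'n::{finite,linorder} point \<Rightarrow> ('v::real_normed_vector, 'n) clop
     \<Rightarrow> ('v, 'n) clop \<Rightarrow> ('v, 'n) clop" where
  "SR_resolvent_mod s T B =
     - (((B o\<^sub>L T) - paravector (conj_point s) \<cdot>\<^sub>l B) o\<^sub>L clifford_inverse (Q_op s T))"

subsection \<open>The defining relations of the Clifford algebra\<close>

lemma clifford_sign_prod:
  "clifford_sign A B = (\<Prod>a\<in>A. \<Prod>b\<in>B. if b \<le> a then - 1 else 1)"
proof -
  have "(\<Prod>a\<in>A. \<Prod>b\<in>B. if b \<le> a then - 1 else (1::real))
      = (\<Prod>p\<in>A \<times> B. if snd p \<le> fst p then - 1 else 1)"
    by (simp add: prod.cartesian_product split_def)
  also have "\<dots> = (\<Prod>p\<in>{p \<in> A \<times> B. snd p \<le> fst p}. - 1)"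
    by (rule prod.inter_filter[symmetric]) simp
  also have "\<dots> = (-1) ^ card {p \<in> A \<times> B. snd p \<le> fst p}"
    by (rule prod_constant)
  also have "{p \<in> A \<times> B. snd p \<le> fst p} = {(a, b). a \<in> A \<and> b \<in> B \<and> b \<le> a}"
    by auto
  finally show ?thesis by (simp add: clifford_sign_def)
qed

lemma prod_sym_diff:
  fixes f :: "'a::finite \<Rightarrow> real"
  assumes "\<And>x. f x * f x = 1"
  shows "prod f (sym_diff A B) = prod f A * prod f B"
proof -
  have A: "prod f A = prod f (A - B) * prod f (A \<inter> B)"
    by (subst prod.union_disjoint[symmetric]) (auto intro: prod.cong)
  have B: "prod f B = prod f (B - A) * prod f (A \<inter> B)"
    by (subst prod.union_disjoint[symmetric]) (auto intro: prod.cong)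
  have "prod f (A \<inter> B) * prod f (A \<inter> B) = 1"
    by (simp add: prod.distrib[symmetric] assms)
  moreover have "prod f (sym_diff A B) = prod f (A - B) * prod f (B - A)"
    by (rule prod.union_disjoint) auto
  ultimately show ?thesis unfolding A B by (simp add: ac_simps)
qed

lemma clifford_sign_left:
  "clifford_sign (sym_diff A B) C = clifford_sign A C * clifford_sign B C"
  unfolding clifford_sign_prod
  by (rule prod_sym_diff) (auto intro!: prod.neutral simp: prod.distrib[symmetric])

lemma clifford_sign_right:
  "clifford_sign A (sym_diff B C) = clifford_sign A B * clifford_sign A C"
  unfolding clifford_sign_prod prod.distrib[symmetric]
  by (intro prod.cong refl prod_sym_diff) simp

lemma clifford_op_axis:
  "clifford_op (T :: 'n::{finite,linorder} set \<Rightarrow> 'v::real_normed_vector \<Rightarrow>\<^sub>L 'v) (axis B v)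
     = (\<Sum>A\<in>UNIV. axis (sym_diff A B) (clifford_sign A B *\<^sub>R T A v))"
proof -
  have "(\<Sum>C\<in>UNIV. axis (sym_diff A C) (clifford_sign A C *\<^sub>R T A (axis B v $ C)))
      = axis (sym_diff A B) (clifford_sign A B *\<^sub>R T A v)" for A
  proof -
    have "(\<Sum>C\<in>UNIV. axis (sym_diff A C) (clifford_sign A C *\<^sub>R T A (axis B v $ C)))
      = (\<Sum>C\<in>UNIV. if C = B then axis (sym_diff A B) (clifford_sign A B *\<^sub>R T A v) else 0)"
      by (intro sum.cong refl) (auto simp: axis_def vec_eq_iff)
    thus ?thesis by simp
  qed
  thus ?thesis by (simp add: clifford_op.rep_eq)
qed

lemma clifford_mult_axis:
  "clifford_mult (axis A r) (axis B v :: ('v::real_normed_vector, 'n::{finite,linorder}) clmod)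
     = axis (sym_diff A B) ((clifford_sign A B * r) *\<^sub>R v)"
proof -
  have "clifford_mult (axis A r) (axis B v)
      = (\<Sum>C\<in>UNIV. if C = A then axis (sym_diff A B) ((clifford_sign A B * r) *\<^sub>R v) else 0)"
    unfolding clifford_mult_def clifford_op_axis
    by (intro sum.cong refl) (auto simp: axis_def vec_eq_iff blinfun.scaleR_left)
  thus ?thesis by simp
qed

lemma clifford_generator_square:
  "clifford_mult (axis {j} 1) (axis {j} 1) = - axis {} (1::real)"
  unfolding clifford_mult_axis clifford_sign_prod by (auto simp: axis_def vec_eq_iff)

lemma clifford_generators_anticommute:
  assumes "j \<noteq> k"
  shows "clifford_mult (axis {j} 1) (axis {k} 1)
    + clifford_mult (axis {k} 1) (axis {j} 1) = (0 :: (real, 'n::{finite,linorder}) clmod)"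
proof -
  have "sym_diff {k} {j} = sym_diff {j} {k}" by auto
  with assms show ?thesis
    unfolding clifford_mult_axis clifford_sign_prod by (auto simp: axis_def vec_eq_iff)
qed

lemma clifford_basis_increasing_product:
  assumes "\<And>k. k \<in> A \<Longrightarrow> j < k"
  shows "clifford_mult (axis {j} 1) (axis A 1)
    = (axis (insert j A) 1 :: (real, 'n::{finite,linorder}) clmod)"
proof -
  have "clifford_sign {j} A = 1"
    unfolding clifford_sign_prod using assms by (auto intro!: prod.neutral simp: not_le)
  moreover have "sym_diff {j} A = insert j A" using assms by auto
  ultimately show ?thesis by (simp add: clifford_mult_axis)
qed

lemma clifford_mult_one:
  "clifford_mult (axis {} 1) (axis A v) = axis A (v::'v::real_normed_vector)"
  by (simp add: clifford_mult_axis clifford_sign_prod)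

lemma clifford_mult_assoc:
  "clifford_mult (axis A 1) (clifford_mult (axis B 1) (axis C v))
     = clifford_mult (clifford_mult (axis A 1) (axis B (1::real)))
         (axis C (v :: 'v::real_normed_vector))"
proof -
  have "sym_diff A (sym_diff B C) = sym_diff (sym_diff A B) C" by auto
  thus ?thesis
    by (simp only: clifford_mult_axis clifford_sign_left clifford_sign_right)
       (simp add: clifford_sign_left clifford_sign_right ac_simps)
qed

end

theory Submission
  imports Defs
begin

text \<open>
  Let \<open>P\<close> and \<open>P'\<close> denote left multiplication by \<open>s\<close> and by its conjugate. Two scalar identities
  hold for a paravector: \<open>P + P' = 2 Re(s)\<close>, and \<open>P P' = P' P = |s|\<^sup>2\<close>, because distinct generators
  anticommute and every generator squares to \<open>-1\<close>
  (\<open>clifford_mult_paravector_add_conj\<close>, \<open>clifford_mult_paravector_compose_conj\<close>).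

  The operator \<open>Q = Q\<^sub>s(T)\<close> is a polynomial in \<open>T\<close> with real coefficients, so \<open>T\<close>, and with it every
  \<open>B\<close> commuting with \<open>T\<close>, commutes with \<open>Q\<close> and hence with \<open>S = Q\<^sup>-\<^sup>1\<close>; neither \<open>B\<close> nor \<open>S\<close>
  commutes with \<open>P\<close> in general. It follows that
  \<open>B S\<^sub>L\<^sup>-\<^sup>1(s, T) = - S (T B - B P')\<close> is already the modified left resolvent, and
  \<open>- S (T B - B P') P + T S (T B - B P') = S (T\<^sup>2 B - T B (P + P') + B P' P) = S Q B = B\<close>.
  Here \<open>P\<close> and \<open>P'\<close> only ever stand on the right of \<open>B\<close>, so they merge into scalars. On the right
  side the roles of left and right are exchanged:
  \<open>- P (B T - P' B) S + (B T - P' B) S T = (B T\<^sup>2 - (P + P') B T + P P' B) S = B Q S = B\<close>.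
\<close>

section \<open>Composition of bounded operators\<close>

lemmas blinfun_compose_linear_simps =
  bounded_bilinear.add_left[OF bounded_bilinear_blinfun_compose]
  bounded_bilinear.add_right[OF bounded_bilinear_blinfun_compose]
  bounded_bilinear.diff_left[OF bounded_bilinear_blinfun_compose]
  bounded_bilinear.diff_right[OF bounded_bilinear_blinfun_compose]
  bounded_bilinear.minus_left[OF bounded_bilinear_blinfun_compose]
  bounded_bilinear.minus_right[OF bounded_bilinear_blinfun_compose]
  bounded_bilinear.scaleR_left[OF bounded_bilinear_blinfun_compose]
  bounded_bilinear.scaleR_right[OF bounded_bilinear_blinfun_compose]

lemma blinfun_compose_id [simp]:
  "id_blinfun o\<^sub>L f = f" "f o\<^sub>L id_blinfun = f"
  by (simp_all add: blinfun_eqI)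

lemma blinfun_compose_assoc: "(f o\<^sub>L g) o\<^sub>L h = f o\<^sub>L (g o\<^sub>L h)"
  by (simp add: blinfun_eqI)

lemma blinfun_compose_left_commute:
  assumes "X o\<^sub>L Y = Y o\<^sub>L X"
  shows "X o\<^sub>L (Y o\<^sub>L Z) = Y o\<^sub>L (X o\<^sub>L Z)"
  by (metis assms blinfun_compose_assoc)

lemma blinfun_compose_inverse_commute:
  assumes "S o\<^sub>L R = id_blinfun" "R o\<^sub>L S = id_blinfun" "X o\<^sub>L R = R o\<^sub>L X"
  shows "S o\<^sub>L X = X o\<^sub>L S"
proof -
  have "S o\<^sub>L X = S o\<^sub>L (X o\<^sub>L R) o\<^sub>L S"
    by (simp add: blinfun_compose_assoc assms(2))
  also have "\<dots> = (S o\<^sub>L R) o\<^sub>L X o\<^sub>L S"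
    by (simp add: blinfun_compose_assoc assms(3))
  finally show ?thesis
    by (simp add: assms(1))
qed

section \<open>Left multiplication by paravectors\<close>

lemma clmod_blinfun_eqI:
  fixes F G :: "('v::real_normed_vector, 'n::finite) clmod \<Rightarrow>\<^sub>L 'w::real_normed_vector"
  assumes "\<And>C v. F (axis C v) = G (axis C v)"
  shows "F = G"
proof (rule blinfun_eqI)
  fix x :: "('v, 'n) clmod"
  have x: "x = (\<Sum>C\<in>UNIV. axis C (x $ C))"
    by (simp add: vec_eq_iff axis_def)
  show "F x = G x"
    by (subst (1 2) x) (simp add: blinfun.sum_right assms)
qed

lemma clifford_mult_add: "clifford_mult (a + b) = clifford_mult a + clifford_mult b"
  by (rule blinfun_eqI)
    (simp add: clifford_mult_def clifford_op.rep_eq blinfun.bilinear_simps algebra_simps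
      sum.distrib[symmetric] axis_def vec_eq_iff if_distrib cong: if_cong)

lemma clifford_mult_zero: "clifford_mult 0 = 0"
  using clifford_mult_add[of 0 0] by simp

lemma clifford_mult_sum: "clifford_mult (sum f I) = (\<Sum>i\<in>I. clifford_mult (f i))"
  by (induction I rule: infinite_finite_induct) (simp_all add: clifford_mult_zero clifford_mult_add)

lemma axis_scaleR_right: "axis A (r *\<^sub>R v) = r *\<^sub>R axis A v"
  by (simp add: axis_def vec_eq_iff)

lemma clifford_mult_axis_scaleR:
  "clifford_mult (axis A r) = r *\<^sub>R clifford_mult (axis A 1)"
  by (rule clmod_blinfun_eqI)
    (simp add: blinfun.scaleR_left clifford_mult_axis axis_scaleR_right mult.commute
      flip: scaleR_scaleR)

lemma clifford_mult_axis_empty: "clifford_mult (axis {} 1) = id_blinfun"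
  by (rule clmod_blinfun_eqI) (simp add: clifford_mult_one)

lemma clifford_mult_axis_compose:
  "clifford_mult (axis A 1) o\<^sub>L clifford_mult (axis B 1)
     = clifford_sign A B *\<^sub>R clifford_mult (axis (sym_diff A B) 1)"
proof (rule clmod_blinfun_eqI)
  fix C v
  have "sym_diff A (sym_diff B C) = sym_diff (sym_diff A B) C"
    by auto
  then show "(clifford_mult (axis A 1) o\<^sub>L clifford_mult (axis B 1)) (axis C v)
      = (clifford_sign A B *\<^sub>R clifford_mult (axis (sym_diff A B) 1)) (axis C v)"
    by (simp add: blinfun.scaleR_left clifford_mult_axis clifford_sign_left clifford_sign_right
        ac_simps flip: axis_scaleR_right)
qed

lemma clifford_mult_generator_square:
  "clifford_mult (axis {j} 1) o\<^sub>L clifford_mult (axis {j} 1) = - id_blinfun"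
  by (simp add: clifford_mult_axis_compose clifford_mult_axis_empty clifford_sign_prod)

lemma clifford_mult_generators_anticommute:
  assumes "j \<noteq> k"
  shows "clifford_mult (axis {j} 1) o\<^sub>L clifford_mult (axis {k} 1)
    = - (clifford_mult (axis {k} 1) o\<^sub>L clifford_mult (axis {j} 1))"
proof -
  have "sym_diff {k} {j} = sym_diff {j} {k}"
    by auto
  with assms show ?thesis
    by (auto simp: clifford_mult_axis_compose clifford_sign_prod)
qed

abbreviation clifford_mult_vector ::
  "(real, 'n::{finite,linorder}) vec \<Rightarrow> ('v::real_normed_vector, 'n) clop" where
  "clifford_mult_vector w \<equiv> \<Sum>j\<in>UNIV. (w $ j) *\<^sub>R clifford_mult (axis {j} 1)"

text \<open>
  Averaging the double sum for the square with its transpose leaves only the diagonal terms,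
  since the mixed products of generators cancel in pairs.
\<close>
lemma clifford_mult_vector_square:
  fixes w :: "(real, 'n::{finite,linorder}) vec"
  shows "clifford_mult_vector w o\<^sub>L clifford_mult_vector w
    = - ((norm w)\<^sup>2 *\<^sub>R (id_blinfun :: ('v::real_normed_vector, 'n) clop))"
    (is "?W o\<^sub>L ?W = _")
proof -
  define E :: "'n \<Rightarrow> ('v, 'n) clop" where "E j = clifford_mult (axis {j} 1)" for j
  have WW: "?W o\<^sub>L ?W = (\<Sum>j\<in>UNIV. \<Sum>k\<in>UNIV. (w $ j * w $ k) *\<^sub>R (E j o\<^sub>L E k))"
    unfolding E_def bounded_bilinear.sum_left[OF bounded_bilinear_blinfun_compose]
    unfolding bounded_bilinear.sum_right[OF bounded_bilinear_blinfun_compose]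
    by (simp add: blinfun_compose_linear_simps mult.commute)
  then have WW': "?W o\<^sub>L ?W = (\<Sum>j\<in>UNIV. \<Sum>k\<in>UNIV. (w $ j * w $ k) *\<^sub>R (E k o\<^sub>L E j))"
    by (subst sum.swap) (simp add: mult.commute)
  have pair: "(E j o\<^sub>L E k) + (E k o\<^sub>L E j) = (if k = j then - 2 *\<^sub>R id_blinfun else 0)" for j k
    by (auto simp: E_def clifford_mult_generator_square scaleR_2
        clifford_mult_generators_anticommute[of j k])
  have "2 *\<^sub>R (?W o\<^sub>L ?W)
      = (\<Sum>j\<in>UNIV. \<Sum>k\<in>UNIV. (w $ j * w $ k) *\<^sub>R ((E j o\<^sub>L E k) + (E k o\<^sub>L E j)))"
    unfolding scaleR_2 by (subst WW, subst WW') (simp add: scaleR_add_right sum.distrib)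
  also have "\<dots> = (\<Sum>j\<in>UNIV. (- 2 * (w $ j)\<^sup>2) *\<^sub>R id_blinfun)"
    by (simp add: pair if_distrib power2_eq_square mult.commute cong: if_cong)
  also have "\<dots> = (- 2 * (\<Sum>j\<in>UNIV. (w $ j)\<^sup>2)) *\<^sub>R id_blinfun"
    by (simp only: scaleR_sum_left sum_distrib_left)
  also have "(\<Sum>j\<in>UNIV. (w $ j)\<^sup>2) = (norm w)\<^sup>2"
    by (simp add: norm_vec_def L2_set_def sum_nonneg)
  also have "(- 2 * (norm w)\<^sup>2) *\<^sub>R id_blinfun
      = 2 *\<^sub>R - ((norm w)\<^sup>2 *\<^sub>R (id_blinfun :: ('v, 'n) clop))"
    by simp
  finally show ?thesis
    unfolding scaleR_cancel_left by simp
qed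

lemma clifford_mult_paravector:
  "clifford_mult (paravector s) = fst s *\<^sub>R id_blinfun + clifford_mult_vector (snd s)"
  unfolding paravector_def clifford_mult_add clifford_mult_sum
    clifford_mult_axis_scaleR[of _ "fst s"] clifford_mult_axis_scaleR[of _ "snd s $ _"]
    clifford_mult_axis_empty ..

lemma clifford_mult_conj_paravector:
  "clifford_mult (paravector (conj_point s)) = fst s *\<^sub>R id_blinfun - clifford_mult_vector (snd s)"
  by (simp add: clifford_mult_paravector conj_point_def sum_negf)

lemma clifford_mult_paravector_add_conj:
  "clifford_mult (paravector s) + clifford_mult (paravector (conj_point s))
     = (2 * fst s) *\<^sub>R id_blinfun"
  unfolding clifford_mult_conj_paravector unfolding clifford_mult_paravector
  by (simp flip: scaleR_left_distrib)

lemma clifford_mult_paravector_compose_conj: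
  "clifford_mult (paravector s) o\<^sub>L clifford_mult (paravector (conj_point s))
     = (norm s)\<^sup>2 *\<^sub>R id_blinfun"
  unfolding clifford_mult_conj_paravector unfolding clifford_mult_paravector
  by (simp add: blinfun_compose_linear_simps clifford_mult_vector_square norm_prod_def
      power2_eq_square algebra_simps flip: scaleR_left_distrib)

lemma clifford_mult_conj_compose_paravector:
  "clifford_mult (paravector (conj_point s)) o\<^sub>L clifford_mult (paravector s)
     = (norm s)\<^sup>2 *\<^sub>R id_blinfun"
  using clifford_mult_paravector_compose_conj[of "conj_point s"]
  by (simp add: conj_point_def norm_prod_def)

section \<open>The modified resolvent equations\<close>

lemma is_clifford_inverse_clifford_inverse:
  assumes "is_clifford_inverse R S"
  shows "is_clifford_inverse R (clifford_inverse R)"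
proof -
  have "S' = S" if "is_clifford_inverse R S'" for S'
    using that assms unfolding is_clifford_inverse_def
    by (metis blinfun_compose_assoc blinfun_compose_id)
  with assms show ?thesis
    unfolding clifford_inverse_def by (metis (full_types) theI)
qed

lemma Q_op_commute:
  assumes "X o\<^sub>L T = T o\<^sub>L X"
  shows "X o\<^sub>L Q_op s T = Q_op s T o\<^sub>L X"
proof -
  have "X o\<^sub>L (T o\<^sub>L T) = T o\<^sub>L (T o\<^sub>L X)"
    by (metis assms blinfun_compose_assoc)
  then show ?thesis
    by (simp add: Q_op_def blinfun_compose_linear_simps blinfun_compose_assoc assms)
qed

theorem theorem6p6:
  fixes T B :: "('v::banach, 'n::{finite,linorder}) clop"
    and s :: "'n point"
  assumes "T \<in> paravector_operators"
    and "B \<in> clifford_operators"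
    and "B o\<^sub>L T = T o\<^sub>L B"
    and "s \<in> S_resolvent_set T"
  shows "(SL_resolvent_mod s T B \<cdot>\<^sub>r paravector s) - (T o\<^sub>L SL_resolvent_mod s T B)
           = ((B o\<^sub>L SL_resolvent s T) \<cdot>\<^sub>r paravector s) - (T o\<^sub>L B o\<^sub>L SL_resolvent s T)
       \<and> ((B o\<^sub>L SL_resolvent s T) \<cdot>\<^sub>r paravector s) - (T o\<^sub>L B o\<^sub>L SL_resolvent s T) = B
       \<and> (paravector s \<cdot>\<^sub>l SR_resolvent_mod s T B) - (SR_resolvent_mod s T B o\<^sub>L T)
           = (paravector s \<cdot>\<^sub>l (SR_resolvent s T o\<^sub>L B)) - (SR_resolvent s T o\<^sub>L B o\<^sub>L T)
       \<and> (paravector s \<cdot>\<^sub>l (SR_resolvent s T o\<^sub>L B)) - (SR_resolvent s T o\<^sub>L B o\<^sub>L T) = B"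
proof -
  define S where "S = clifford_inverse (Q_op s T)"
  define P P' :: "('v, 'n) clop"
    where "P = clifford_mult (paravector s)" and "P' = clifford_mult (paravector (conj_point s))"
  note BT = assms(3)
  have SQ: "S o\<^sub>L Q_op s T = id_blinfun" and QS: "Q_op s T o\<^sub>L S = id_blinfun"
    using assms(4) is_clifford_inverse_clifford_inverse
    unfolding S_resolvent_set_def S_def is_clifford_inverse_def by blast+
  have ST: "S o\<^sub>L T = T o\<^sub>L S"
    by (rule blinfun_compose_inverse_commute[OF SQ QS Q_op_commute]) simp
  have SB: "S o\<^sub>L B = B o\<^sub>L S"
    by (rule blinfun_compose_inverse_commute[OF SQ QS Q_op_commute]) (rule BT)
  have sum: "P + P' = (2 * fst s) *\<^sub>R id_blinfun"
    unfolding P_def P'_def by (rule clifford_mult_paravector_add_conj)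
  have PP': "P o\<^sub>L P' = (norm s)\<^sup>2 *\<^sub>R id_blinfun" and P'P: "P' o\<^sub>L P = (norm s)\<^sup>2 *\<^sub>R id_blinfun"
    unfolding P_def P'_def
    by (rule clifford_mult_paravector_compose_conj clifford_mult_conj_compose_paravector)+

  have L: "SL_resolvent_mod s T B = - (S o\<^sub>L ((T o\<^sub>L B) - (B o\<^sub>L P')))"
    by (simp add: SL_resolvent_mod_def S_def P'_def op_rmult_def)
  \<comment> \<open>\<open>B\<close> moves past \<open>S\<close> and \<open>T\<close> but stays to the left of \<open>P'\<close>, with which it does not commute in general.\<close>
  have L': "B o\<^sub>L SL_resolvent s T = SL_resolvent_mod s T B"
    unfolding L
    by (simp add: SL_resolvent_def op_lmult_def blinfun_compose_linear_simps
        blinfun_compose_left_commute[OF SB] flip: BT S_def P'_def)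
  have "(SL_resolvent_mod s T B \<cdot>\<^sub>r paravector s) - (T o\<^sub>L SL_resolvent_mod s T B)
      = S o\<^sub>L ((T o\<^sub>L T o\<^sub>L B) - (T o\<^sub>L B o\<^sub>L (P + P')) + (B o\<^sub>L (P' o\<^sub>L P)))"
    unfolding L
    by (simp add: op_rmult_def blinfun_compose_linear_simps blinfun_compose_assoc
        blinfun_compose_left_commute[OF ST] flip: P_def)
  also have "\<dots> = S o\<^sub>L (Q_op s T o\<^sub>L B)"
    by (simp add: P'P sum Q_op_def blinfun_compose_linear_simps blinfun_compose_assoc)
  finally have Left: "(SL_resolvent_mod s T B \<cdot>\<^sub>r paravector s) - (T o\<^sub>L SL_resolvent_mod s T B) = B"
    by (simp add: SQ flip: blinfun_compose_assoc)

  have R: "SR_resolvent_mod s T B = - (((B o\<^sub>L T) - (P' o\<^sub>L B)) o\<^sub>L S)"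
    by (simp add: SR_resolvent_mod_def S_def P'_def op_lmult_def)
  have R': "SR_resolvent s T o\<^sub>L B = SR_resolvent_mod s T B"
    unfolding R
    by (simp add: SR_resolvent_def op_lmult_def blinfun_compose_linear_simps BT SB
        blinfun_compose_assoc flip: S_def P'_def)
  have "(paravector s \<cdot>\<^sub>l SR_resolvent_mod s T B) - (SR_resolvent_mod s T B o\<^sub>L T)
      = ((B o\<^sub>L T o\<^sub>L T) - ((P + P') o\<^sub>L B o\<^sub>L T) + ((P o\<^sub>L P') o\<^sub>L B)) o\<^sub>L S"
    unfolding R
    by (simp add: op_lmult_def blinfun_compose_linear_simps blinfun_compose_assoc ST
        flip: P_def)
  also have "\<dots> = (B o\<^sub>L Q_op s T) o\<^sub>L S"
    by (simp add: PP' sum Q_op_def blinfun_compose_linear_simps blinfun_compose_assoc)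
  finally have Right: "(paravector s \<cdot>\<^sub>l SR_resolvent_mod s T B) - (SR_resolvent_mod s T B o\<^sub>L T) = B"
    by (simp add: QS blinfun_compose_assoc)

  show ?thesis
    using Left Right by (simp add: blinfun_compose_assoc L' R')
qed

end
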